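(* The infinite rank grammic monoid $\mathbb{G}_{\mathbb{N}}$ does not satisfy any non-trivial semigroup identity.
   Context: Let $\mathbb{N}=\{1<2<3<\cdots\}$ be the positive integers and $\mathbb{N}^*$ the free monoid on the set $\mathbb{N}$. A finite bottom row over $\mathbb{N}$ is a finitely supported sequence $\gamma=(\gamma_i)_{i\in\mathbb{N}}$ of non-negative integers (encoding the weakly increasing row with $\gamma_i$ symbols $i$). Each letter $a\in\mathbb{N}$ acts on the right on finite bottom rows: let $t=\min\{s\in\mathbb{N}: s>a,\ \gamma_s>0\}$ if this set is non-empty; then $\gamma\cdot a=\gamma+e_a-e_t$ if $t$ is defined, and $\gamma\cdot a=\gamma+e_a$ otherwise, where $e_i$ is the sequence with a $1$ in position $i$ and $0$ elsewhere. This extends to words by $\gamma\cdot\varepsilon=\gamma$ and $\gamma\cdot(w_1\cdots w_k)=(\cdots(\gamma\cdot w_1)\cdots)\cdot w_k$. For $u,v\in\mathbb{N}^*$, $u\equiv_{\rm Gram}v$ means $\gamma\cdot u=\gamma\cdot v$ for all finite bottom rows $\gamma$; this is a congruence, and $\mathbb{G}_{\mathbb{N}}=\mathbb{N}^*/\equiv_{\rm Gram}$ is the grammic monoid of infinite rank. A semigroup identity over a (finite) alphabet $\Sigma$ is a pair of words $u=v$ with $u,v\in\Sigma^+$ (the free semigroup on $\Sigma$); it is non-trivial if $u$ and $v$ are distinct words. A semigroup $S$ satisfies it if every morphism $\Sigma^+\to S$ maps $u$ and $v$ to the same element. *)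

theory Defs
  imports "HOL-Library.Poly_Mapping"
begin

typedef pnat = "{n :: nat. 0 < n}"
  morphisms nat_of_pnat Abs_pnat
  by auto

setup_lifting type_definition_pnat

instantiation pnat :: wellorder
begin

lift_definition less_eq_pnat :: "pnat \<Rightarrow> pnat \<Rightarrow> bool" is "(\<le>)" .
lift_definition less_pnat :: "pnat \<Rightarrow> pnat \<Rightarrow> bool" is "(<)" .

instance
proof
  fix x y z :: pnat
  show "x < y \<longleftrightarrow> x \<le> y \<and> \<not> y \<le> x" by transfer auto
  show "x \<le> x" by transfer auto
  show "x \<le> y \<Longrightarrow> y \<le> z \<Longrightarrow> x \<le> z" by transfer auto
  show "x \<le> y \<Longrightarrow> y \<le> x \<Longrightarrow> x = y" by transfer auto
  show "x \<le> y \<or> y \<le> x" by transfer auto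
next
  fix P :: "pnat \<Rightarrow> bool" and a :: pnat
  assume step: "\<And>x. (\<And>y. y < x \<Longrightarrow> P y) \<Longrightarrow> P x"
  show "P a"
  proof (induction "nat_of_pnat a" arbitrary: a rule: less_induct)
    case less
    show ?case by (rule step) (simp add: less less_pnat.rep_eq)
  qed
qed

end

type_synonym bottom_row = "pnat \<Rightarrow>\<^sub>0 nat"

text \<open>The pointwise subtraction on \<^typ>\<open>nat\<close> does not truncate: it takes one from an entry that is positive.\<close>

definition act_letter :: "bottom_row \<Rightarrow> pnat \<Rightarrow> bottom_row" where
  "act_letter \<gamma> a =
     (if \<exists>s. s > a \<and> Poly_Mapping.lookup \<gamma> s > 0
      then \<gamma> + Poly_Mapping.single a 1
             - Poly_Mapping.single (LEAST s. s > a \<and> Poly_Mapping.lookup \<gamma> s > 0) 1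
      else \<gamma> + Poly_Mapping.single a 1)"

definition act :: "bottom_row \<Rightarrow> pnat list \<Rightarrow> bottom_row" where
  "act = foldl act_letter"

definition gram_eq :: "pnat list \<Rightarrow> pnat list \<Rightarrow> bool" where
  "gram_eq u v \<longleftrightarrow> (\<forall>\<gamma>. act \<gamma> u = act \<gamma> v)"

lemma act_append: "act \<gamma> (u @ v) = act (act \<gamma> u) v"
  by (simp add: act_def)

quotient_type grammic = "pnat list" / gram_eq
  by (rule equivpI) (auto simp: reflp_def symp_def transp_def gram_eq_def)

instantiation grammic :: monoid_mult
begin

lift_definition one_grammic :: grammic is "[]" .

lift_definition times_grammic :: "grammic \<Rightarrow> grammic \<Rightarrow> grammic" is "(@)"
  by (simp add: gram_eq_def act_append)

instance
  by standard (transfer, simp add: gram_eq_def)+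

end

definition free_semigroup :: "'a set \<Rightarrow> 'a list set" where
  "free_semigroup \<Sigma> = lists \<Sigma> - {[]}"

text \<open>Only the values of a morphism on \<^term>\<open>free_semigroup \<Sigma>\<close> are constrained; its values on
  other lists are irrelevant.\<close>

definition semigroup_morphism :: "'a set \<Rightarrow> ('a list \<Rightarrow> 's::semigroup_mult) \<Rightarrow> bool" where
  "semigroup_morphism \<Sigma> \<phi> \<longleftrightarrow>
     (\<forall>x \<in> free_semigroup \<Sigma>. \<forall>y \<in> free_semigroup \<Sigma>. \<phi> (x @ y) = \<phi> x * \<phi> y)"

definition satisfies_identity ::
    "'s::semigroup_mult itself \<Rightarrow> 'a set \<Rightarrow> 'a list \<Rightarrow> 'a list \<Rightarrow> bool" where
  "satisfies_identity S \<Sigma> u v \<longleftrightarrow>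
     (\<forall>\<phi> :: 'a list \<Rightarrow> 's. semigroup_morphism \<Sigma> \<phi> \<longrightarrow> \<phi> u = \<phi> v)"

end

theory Submission
  imports Defs
begin

text \<open>
  The number of entries at most \<open>i\<close> in a bottom row evolves by a max-plus rule under the action.
  If a letter \<open>x\<close> is substituted by the decreasing word in which each \<open>p\<close> is repeated \<open>W x p\<close> times,
  the length of the bottom row obtained from the empty one by a word \<open>w\<close> is the maximum of
  \<open>\<Sum>j. W (w ! j) (p j)\<close> over all weakly increasing sequences of positions \<open>p\<close>.
  Let \<open>c\<close> be the word \<open>u @ v\<close>, and let \<open>W x p\<close> be \<open>B ^ length c + B ^ p\<close> if \<open>c ! p = x\<close> and \<open>0\<close>
  otherwise. The leading term forces an optimal sequence to spell \<open>w\<close> in \<open>c\<close> whenever that is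
  possible, as it is for both \<open>u\<close> and \<open>v\<close>, and the terms \<open>B ^ p\<close> encode the sequence itself as digits
  in base \<open>B\<close>. Hence the length of the resulting bottom row determines \<open>w\<close>.
\<close>

section \<open>Partial sums of bottom rows\<close>

text \<open>Letters are numbered from 0, so that list positions can serve as letters.\<close>

definition pos :: "nat \<Rightarrow> pnat" where
  "pos p = Abs_pnat (Suc p)"

lemma nat_of_pnat_pos [simp]: "nat_of_pnat (pos p) = Suc p"
  by (simp add: pos_def Abs_pnat_inverse)

lemma pos_less_iff [simp]: "pos p < pos q \<longleftrightarrow> p < q"
  by (simp add: less_pnat.rep_eq)

lemma pos_eq_iff [simp]: "pos p = pos q \<longleftrightarrow> p = q"
  by (metis nat_of_pnat_pos nat.inject)

lemma pos_surj: obtains p where "s = pos p"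
proof
  have "0 < nat_of_pnat s" using nat_of_pnat by simp
  then show "s = pos (nat_of_pnat s - 1)" by (simp add: pos_def nat_of_pnat_inverse)
qed

definition row_sum :: "bottom_row \<Rightarrow> nat \<Rightarrow> nat" where
  "row_sum \<gamma> i = (\<Sum>p\<le>i. Poly_Mapping.lookup \<gamma> (pos p))"

lemma row_sum_zero [simp]: "row_sum 0 i = 0"
  by (simp add: row_sum_def)

lemma row_sum_add: "row_sum (\<gamma> + \<delta>) i = row_sum \<gamma> i + row_sum \<delta> i"
  by (simp add: row_sum_def lookup_add sum.distrib)

lemma row_sum_single: "row_sum (Poly_Mapping.single (pos a) n) i = (if a \<le> i then n else 0)"
  by (simp add: row_sum_def lookup_single when_def)

lemma row_sum_mono: "i \<le> j \<Longrightarrow> row_sum \<gamma> i \<le> row_sum \<gamma> j"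
  unfolding row_sum_def by (rule sum_mono2) auto

lemma row_sum_strict_mono:
  assumes "a < t" "t \<le> i" "0 < Poly_Mapping.lookup \<gamma> (pos t)"
  shows "row_sum \<gamma> a < row_sum \<gamma> i"
  unfolding row_sum_def by (rule sum_strict_mono2[where b = t]) (use assms in auto)

lemma row_sum_eq:
  assumes "a \<le> i" "\<And>p. a < p \<Longrightarrow> p \<le> i \<Longrightarrow> Poly_Mapping.lookup \<gamma> (pos p) = 0"
  shows "row_sum \<gamma> i = row_sum \<gamma> a"
  unfolding row_sum_def by (rule sum.mono_neutral_right) (use assms in auto)

text \<open>Inserting \<open>a\<close> raises every sum from \<open>a\<close> on by one, and
  removing the bumped letter \<open>t\<close> undoes this from \<open>t\<close> on. Before
  \<open>t\<close> the sum still equals that at \<open>a\<close>; from \<open>t\<close> on it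
  already exceeds it.\<close>

lemma row_sum_act_letter:
  "row_sum (act_letter \<gamma> (pos a)) i =
     (if a \<le> i then max (row_sum \<gamma> i) (row_sum \<gamma> a + 1) else row_sum \<gamma> i)"
proof (cases "\<exists>s. s > pos a \<and> Poly_Mapping.lookup \<gamma> s > 0")
  case True
  define s where "s = (LEAST s. s > pos a \<and> Poly_Mapping.lookup \<gamma> s > 0)"
  obtain t where t: "s = pos t" by (rule pos_surj)
  have s: "s > pos a" "Poly_Mapping.lookup \<gamma> s > 0"
    using LeastI_ex[OF True] by (simp_all add: s_def)
  have below: "Poly_Mapping.lookup \<gamma> (pos p) = 0" if "a < p" "p < t" for p
    using not_less_Least[of "pos p" "\<lambda>s. s > pos a \<and> Poly_Mapping.lookup \<gamma> s > 0"] that t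
    by (simp add: s_def)
  \<comment> \<open>\<open>row_sum\<close> is additive, but subtraction of rows truncates; adding
    the bumped letter back turns the action into an equation between sums.\<close>
  have "act_letter \<gamma> (pos a) + Poly_Mapping.single (pos t) 1
      = \<gamma> + Poly_Mapping.single (pos a) 1 - Poly_Mapping.single s 1 + Poly_Mapping.single s 1"
    using True t by (simp add: act_letter_def s_def)
  also have "\<dots> = \<gamma> + Poly_Mapping.single (pos a) 1"
    by (rule poly_mapping_eqI) (use s in \<open>auto simp: lookup_add lookup_minus lookup_single when_def\<close>)
  finally have "row_sum (act_letter \<gamma> (pos a) + Poly_Mapping.single (pos t) 1) i
      = row_sum (\<gamma> + Poly_Mapping.single (pos a) 1) i" by simp
  then have *: "row_sum (act_letter \<gamma> (pos a)) i + (if t \<le> i then 1 else 0)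
      = row_sum \<gamma> i + (if a \<le> i then 1 else 0)"
    by (simp only: row_sum_add row_sum_single)
  have "a < t" using s t by simp
  consider "i < a" | "a \<le> i" "i < t" | "t \<le> i" by linarith
  then show ?thesis
  proof cases
    case 1
    then show ?thesis using * \<open>a < t\<close> by simp
  next
    case 2
    then have "row_sum \<gamma> i = row_sum \<gamma> a" by (intro row_sum_eq below) auto
    then show ?thesis using * 2 by simp
  next
    case 3
    then have "row_sum \<gamma> a < row_sum \<gamma> i" using s t \<open>a < t\<close> by (intro row_sum_strict_mono) auto
    then show ?thesis using * 3 \<open>a < t\<close> by simp
  qed
next
  case False
  then have "row_sum \<gamma> i = row_sum \<gamma> a" if "a \<le> i"
    using that by (intro row_sum_eq) auto
  then show ?thesis
    using False by (auto simp: act_letter_def row_sum_add row_sum_single)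
qed

lemma act_Nil [simp]: "act \<gamma> [] = \<gamma>"
  by (simp add: act_def)

lemma act_Cons [simp]: "act \<gamma> (a # w) = act (act_letter \<gamma> a) w"
  by (simp add: act_def)

lemma row_sum_act_ge: "row_sum \<gamma> i \<le> row_sum (act \<gamma> w) i"
proof (induction w arbitrary: \<gamma>)
  case (Cons a w)
  obtain p where "a = pos p" by (rule pos_surj)
  then have "row_sum \<gamma> i \<le> row_sum (act_letter \<gamma> a) i" by (simp add: row_sum_act_letter)
  also have "\<dots> \<le> row_sum (act \<gamma> (a # w)) i" using Cons.IH by simp
  finally show ?case .
qed simp

lemma row_sum_act_replicate:
  "row_sum (act \<gamma> (replicate n (pos a))) i =
     (if a \<le> i then max (row_sum \<gamma> i) (row_sum \<gamma> a + n) else row_sum \<gamma> i)"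
  by (induction n arbitrary: \<gamma>) (auto simp: row_sum_act_letter max_def intro: order.antisym row_sum_mono)

section \<open>Decreasing blocks\<close>

text \<open>A letter changes only the sums at or above itself, so in decreasing order each letter
  meets the sum that the row had before the block. Increments within one block therefore do not
  chain.\<close>

definition decreasing_block :: "(nat \<Rightarrow> nat) \<Rightarrow> nat \<Rightarrow> pnat list" where
  "decreasing_block m n = concat (map (\<lambda>p. replicate (m p) (pos p)) (rev [0..<n]))"

lemma decreasing_block_0 [simp]: "decreasing_block m 0 = []"
  by (simp add: decreasing_block_def)

lemma decreasing_block_Suc [simp]:
  "decreasing_block m (Suc n) = replicate (m n) (pos n) @ decreasing_block m n"
  by (simp add: decreasing_block_def)

text \<open>The letters above \<open>p\<close> leave the sum at \<open>p\<close> alone, and the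
  letters after \<open>p\<close> decrease no sum.\<close>

lemma row_sum_decreasing_block_ge:
  assumes "p < n" "p \<le> i"
  shows "row_sum \<gamma> p + m p \<le> row_sum (act \<gamma> (decreasing_block m n)) i"
  using assms
proof (induction n arbitrary: \<gamma>)
  case (Suc n)
  let ?\<delta> = "act \<gamma> (replicate (m n) (pos n))"
  have "row_sum \<gamma> p + m p \<le> row_sum (act ?\<delta> (decreasing_block m n)) i"
  proof (cases "p = n")
    case True
    then have "row_sum \<gamma> p + m p \<le> row_sum ?\<delta> i"
      using Suc.prems by (simp add: row_sum_act_replicate)
    then show ?thesis using row_sum_act_ge le_trans by blast
  next
    case False
    then have "row_sum ?\<delta> p = row_sum \<gamma> p" using Suc.prems by (simp add: row_sum_act_replicate)
    then show ?thesis using Suc.IH[of ?\<delta>] Suc.prems False by simp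
  qed
  then show ?case by (simp add: act_append)
qed simp

lemma row_sum_decreasing_block_cases:
  "row_sum (act \<gamma> (decreasing_block m n)) i = row_sum \<gamma> i \<or>
   (\<exists>p<n. p \<le> i \<and> row_sum (act \<gamma> (decreasing_block m n)) i = row_sum \<gamma> p + m p)"
proof (induction n arbitrary: \<gamma>)
  case (Suc n)
  let ?\<delta> = "act \<gamma> (replicate (m n) (pos n))"
  let ?r = "row_sum (act ?\<delta> (decreasing_block m n)) i"
  have "?r = row_sum \<gamma> i \<or> (\<exists>p<Suc n. p \<le> i \<and> ?r = row_sum \<gamma> p + m p)"
    using Suc.IH[of ?\<delta>]
  proof (elim disjE exE conjE)
    assume "?r = row_sum ?\<delta> i"
    then show ?thesis by (auto simp: row_sum_act_replicate max_def)
  next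
    fix p assume "p < n" "p \<le> i" "?r = row_sum ?\<delta> p + m p"
    then have "?r = row_sum \<gamma> p + m p" by (simp add: row_sum_act_replicate)
    then show ?thesis using \<open>p < n\<close> \<open>p \<le> i\<close> less_SucI by blast
  qed
  then show ?case by (simp add: act_append)
qed simp

lemma row_sum_decreasing_block_attained:
  assumes "i < n"
  shows "\<exists>p\<le>i. row_sum (act \<gamma> (decreasing_block m n)) i = row_sum \<gamma> p + m p"
proof (cases "row_sum (act \<gamma> (decreasing_block m n)) i = row_sum \<gamma> i")
  case True
  \<comment> \<open>If the sum at \<open>i\<close> is unchanged, the lower bound for
    \<open>p = i\<close> forces \<open>m i = 0\<close>, so \<open>i\<close> itself is a
    witness.\<close>
  then show ?thesis using row_sum_decreasing_block_ge[of i n i \<gamma> m] assms by auto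
next
  case False
  then show ?thesis using row_sum_decreasing_block_cases[of \<gamma> m n i] by auto
qed

definition block_word :: "('a \<Rightarrow> nat \<Rightarrow> nat) \<Rightarrow> nat \<Rightarrow> 'a list \<Rightarrow> pnat list" where
  "block_word W n w = concat (map (\<lambda>x. decreasing_block (W x) n) w)"

lemma block_word_append: "block_word W n (w @ w') = block_word W n w @ block_word W n w'"
  by (simp add: block_word_def)

lemma block_word_snoc:
  "block_word W n (w @ [x]) = block_word W n w @ decreasing_block (W x) n"
  by (simp add: block_word_def)

text \<open>The one-block bound is chained from the last letter backwards: the last position bounds
  the earlier ones and becomes the new \<open>i\<close>.\<close>

lemma row_sum_block_word_ge:
  assumes "length ps = length w" "sorted ps" "\<forall>p\<in>set ps. p \<le> i" "i < n"
  shows "sum_list (map2 W w ps) \<le> row_sum (act 0 (block_word W n w)) i"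
  using assms
proof (induction w arbitrary: ps i rule: rev_induct)
  case (snoc x w)
  obtain qs p where ps: "ps = qs @ [p]"
    using snoc.prems(1) by (cases ps rule: rev_cases) auto
  have "sum_list (map2 W w qs) \<le> row_sum (act 0 (block_word W n w)) p"
    using snoc.prems ps by (intro snoc.IH) (auto simp: sorted_append)
  moreover have "row_sum (act 0 (block_word W n w)) p + W x p
      \<le> row_sum (act (act 0 (block_word W n w)) (decreasing_block (W x) n)) i"
    using snoc.prems ps by (intro row_sum_decreasing_block_ge) auto
  ultimately show ?case
    using snoc.prems ps by (simp add: block_word_snoc act_append)
qed simp

lemma row_sum_block_word_attained:
  assumes "i < n"
  shows "\<exists>ps. length ps = length w \<and> sorted ps \<and> (\<forall>p\<in>set ps. p \<le> i) \<and>
    row_sum (act 0 (block_word W n w)) i = sum_list (map2 W w ps)"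
  using assms
proof (induction w arbitrary: i rule: rev_induct)
  case Nil
  then show ?case by (simp add: block_word_def)
next
  case (snoc x w)
  obtain p where p: "p \<le> i"
      "row_sum (act (act 0 (block_word W n w)) (decreasing_block (W x) n)) i
        = row_sum (act 0 (block_word W n w)) p + W x p"
    using row_sum_decreasing_block_attained[OF snoc.prems] by blast
  obtain qs where "length qs = length w" "sorted qs" "\<forall>q\<in>set qs. q \<le> p"
      "row_sum (act 0 (block_word W n w)) p = sum_list (map2 W w qs)"
    using snoc.IH[of p] p snoc.prems by auto
  then show ?case
    using p by (intro exI[of _ "qs @ [p]"])
      (auto simp: sorted_append block_word_snoc act_append)
qed

section \<open>Encoding readings in a base\<close>

lemma sum_list_powers_le:
  fixes B :: nat
  assumes "0 < B" "\<forall>p\<in>set ps. p \<le> b"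
  shows "sum_list (map (power B) ps) \<le> length ps * B ^ b"
  using assms(2)
proof (induction ps)
  case (Cons p ps)
  then have "B ^ p \<le> B ^ b" using \<open>0 < B\<close> by (intro power_increasing) auto
  then show ?case using Cons by simp
qed simp

text \<open>Each power is at most \<open>B ^ (b - 1)\<close>, and fewer than \<open>B\<close> of
  them are added, so there is no carry into digit \<open>b\<close>.\<close>

lemma sum_list_powers_less:
  fixes B :: nat
  assumes "length ps < B" "\<forall>p\<in>set ps. p < b"
  shows "sum_list (map (power B) ps) < B ^ b"
proof (cases "ps = []")
  case False
  then obtain b' where b: "b = Suc b'" using assms(2) by (cases b) auto
  have "sum_list (map (power B) ps) \<le> length ps * B ^ b'"
    using assms b by (intro sum_list_powers_le) auto
  also have "\<dots> < B * B ^ b'" using assms(1) by (intro mult_strict_right_mono) auto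
  finally show ?thesis using b by simp
qed (use assms in simp)

lemma sorted_eq_if_sum_list_powers_eq:
  fixes B :: nat
  assumes "length ps = length qs" "length ps < B" "sorted ps" "sorted qs"
    "sum_list (map (power B) ps) = sum_list (map (power B) qs)"
  shows "ps = qs"
  using assms
proof (induction ps arbitrary: qs rule: rev_induct)
  case (snoc p ps)
  obtain qs' q where qs: "qs = qs' @ [q]"
    using snoc.prems(1) by (cases qs rule: rev_cases) auto
  \<comment> \<open>The last entry of a sorted list is its largest. If the last entries differ, the
    sum with the smaller one stays below the single power \<open>B ^ y\<close> in the other.\<close>
  have less: False
    if "length xs < B" "sorted (xs @ [x])" "x < y"
       "sum_list (map (power B) (xs @ [x])) = sum_list (map (power B) (ys @ [y]))"
       "length (xs @ [x]) < B"
    for xs ys :: "nat list" and x y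
  proof -
    have "sum_list (map (power B) (xs @ [x])) < B ^ y"
      using that by (intro sum_list_powers_less) (auto simp: sorted_append)
    then show False using that(4) by simp
  qed
  have "\<not> p < q" using less[of ps p q qs'] snoc.prems qs by auto
  moreover have "\<not> q < p" using less[of qs' q p ps] snoc.prems qs by auto
  ultimately have "p = q" by simp
  moreover have "ps = qs'"
    using snoc.prems qs \<open>p = q\<close> by (intro snoc.IH) (auto simp: sorted_append)
  ultimately show ?case using qs by simp
qed simp

definition reading_weight :: "'a list \<Rightarrow> nat \<Rightarrow> 'a \<Rightarrow> nat \<Rightarrow> nat" where
  "reading_weight c B x p = (if c ! p = x then B ^ length c + B ^ p else 0)"

lemma sum_list_reading_weight_map_nth:
  "sum_list (map2 (reading_weight c B) (map ((!) c) ps) ps)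
     = length ps * B ^ length c + sum_list (map (power B) ps)"
  by (induction ps) (simp_all add: reading_weight_def)

text \<open>A mismatched position contributes 0, so a single mismatch already costs a full leading
  term \<open>B ^ length c\<close>.\<close>

lemma sum_list_reading_weight_cases:
  assumes "length w = length ps"
  shows "w = map ((!) c) ps \<or>
    sum_list (map2 (reading_weight c B) w ps) + B ^ length c
      \<le> length ps * B ^ length c + sum_list (map (power B) ps)"
  using assms
proof (induction w ps rule: list_induct2)
  case (Cons x w p ps)
  then show ?case
    using sum_list_reading_weight_map_nth[of c B ps] by (auto simp: reading_weight_def)
qed simp

lemma optimal_reading:
  assumes "c = xs @ w @ ys" "c \<noteq> []" "length w < B"
  shows "\<exists>ps. w = map ((!) c) ps \<and> sorted ps \<and>
    sum_list (map (power B) ps) < B ^ length c \<and>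
    row_sum (act 0 (block_word (reading_weight c B) (length c) w)) (length c - 1)
      = length w * B ^ length c + sum_list (map (power B) ps)"
    (is "\<exists>ps. _ \<and> _ \<and> _ \<and> ?r = _")
proof -
  \<comment> \<open>These are the positions that the factor \<open>w\<close> occupies in
    \<open>c\<close>; they give a reading without mismatch.\<close>
  define js where "js = [length xs..<length xs + length w]"
  have js: "w = map ((!) c) js"
    by (rule nth_equalityI) (auto simp: js_def assms(1) nth_append)
  have n: "length c - 1 < length c" using assms(2) by simp
  have "sum_list (map2 (reading_weight c B) w js) \<le> ?r"
    by (rule row_sum_block_word_ge) (use n in \<open>auto simp: js_def assms(1)\<close>)
  moreover have "sum_list (map2 (reading_weight c B) w js)
      = length js * B ^ length c + sum_list (map (power B) js)"
    by (subst js) (rule sum_list_reading_weight_map_nth)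
  moreover have "length js = length w" by (simp add: js_def)
  ultimately have ge: "length w * B ^ length c \<le> ?r" by simp
  obtain ps where ps: "length ps = length w" "sorted ps" "\<forall>p\<in>set ps. p \<le> length c - 1"
      "?r = sum_list (map2 (reading_weight c B) w ps)"
    using row_sum_block_word_attained[OF n] by blast
  have less: "sum_list (map (power B) ps) < B ^ length c"
    using ps n assms(3) by (intro sum_list_powers_less) fastforce+
  \<comment> \<open>With a mismatch, \<open>?r + B ^ length c\<close> would be less than
    \<open>(length w + 1) * B ^ length c\<close>, contradicting \<open>ge\<close>.\<close>
  have w: "w = map ((!) c) ps"
    using sum_list_reading_weight_cases[of w ps c B] ps(1,4) ge less by simp
  have "sum_list (map2 (reading_weight c B) w ps)
      = length ps * B ^ length c + sum_list (map (power B) ps)"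
    by (subst w) (rule sum_list_reading_weight_map_nth)
  then have "?r = length w * B ^ length c + sum_list (map (power B) ps)"
    by (simp only: ps(1,4))
  then show ?thesis using w ps(2) less by blast
qed

text \<open>Both words are factors of \<open>u @ v\<close>, so each row length has quotient the word
  length and remainder the encoded positions on division by \<open>M\<close>. Equal positions spell
  equal words.\<close>

lemma eq_if_gram_eq_block_words:
  assumes "gram_eq (block_word (reading_weight (u @ v) B) (length (u @ v)) u)
                   (block_word (reading_weight (u @ v) B) (length (u @ v)) v)"
    and "length (u @ v) < B"
  shows "u = v"
proof (cases "u @ v = []")
  case False
  define c where "c = u @ v"
  define M where "M = B ^ length c"
  obtain ps where ps: "u = map ((!) c) ps" "sorted ps" "sum_list (map (power B) ps) < M"
      "row_sum (act 0 (block_word (reading_weight c B) (length c) u)) (length c - 1)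
        = length u * M + sum_list (map (power B) ps)"
    using optimal_reading[of c "[]" u v B] False assms(2) by (auto simp: c_def M_def)
  obtain qs where qs: "v = map ((!) c) qs" "sorted qs" "sum_list (map (power B) qs) < M"
      "row_sum (act 0 (block_word (reading_weight c B) (length c) v)) (length c - 1)
        = length v * M + sum_list (map (power B) qs)"
    using optimal_reading[of c u v "[]" B] False assms(2) by (auto simp: c_def M_def)
  have eq: "length u * M + sum_list (map (power B) ps) = length v * M + sum_list (map (power B) qs)"
    using assms(1) ps(4) qs(4) by (simp add: gram_eq_def c_def)
  have "length u = (length u * M + sum_list (map (power B) ps)) div M" using ps(3) by simp
  also have "\<dots> = length v" unfolding eq using qs(3) by simp
  finally have len: "length u = length v" .
  have "ps = qs"
  proof (rule sorted_eq_if_sum_list_powers_eq)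
    have "length ps = length u" "length qs = length v" using ps(1) qs(1) by (metis length_map)+
    then show "length ps = length qs" "length ps < B" using len assms(2) by simp_all
    show "sum_list (map (power B) ps) = sum_list (map (power B) qs)" using eq len by simp
  qed (fact ps(2) qs(2))+
  then show ?thesis by (simp only: ps(1) qs(1))
qed simp

theorem corollary4p7:
  fixes \<Sigma> :: "'a set" and u v :: "'a list"
  assumes "finite \<Sigma>"
    and "u \<in> free_semigroup \<Sigma>" and "v \<in> free_semigroup \<Sigma>"
    and "u \<noteq> v"
  shows "\<not> satisfies_identity TYPE(grammic) \<Sigma> u v"
proof
  assume sat: "satisfies_identity TYPE(grammic) \<Sigma> u v"
  \<comment> \<open>The base exceeds the length of \<open>u @ v\<close>, hence the number of powers
    added for either word.\<close>
  define f where
    "f = block_word (reading_weight (u @ v) (Suc (length (u @ v)))) (length (u @ v))"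
  have "abs_grammic (f (x @ y)) = abs_grammic (f x) * abs_grammic (f y)" for x y
    by (simp add: f_def block_word_append times_grammic.abs_eq)
  then have "semigroup_morphism \<Sigma> (\<lambda>x. abs_grammic (f x))"
    by (simp add: semigroup_morphism_def)
  then have "abs_grammic (f u) = abs_grammic (f v)"
    using sat[unfolded satisfies_identity_def, rule_format, of "\<lambda>x. abs_grammic (f x)"] by simp
  then have "gram_eq (f u) (f v)" by (simp add: grammic.abs_eq_iff)
  then have "u = v" unfolding f_def by (rule eq_if_gram_eq_block_words) simp
  then show False using assms(4) by simp
qed

end
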